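(* Let $m,k$ be positive integers. There is a bijection between the set $\mathcal{Q}(m,k)$ and the set $\mathcal{SD}(2m,2k)$.
   Context: For a positive integer $k$ and real $s$, a free ballot $(s,k)$-path of height $n$ is a lattice path from $(0,0)$ to $(s,n)$ with up steps $(k/2,1)$, down steps $(k/2,-1)$ and horizontal steps $(\ell,0)$ ($\ell$ an integer, $1\le\ell<k$), allowed to go below the $x$-axis. $\mathcal{FB}'_n(s,k)$ is the set of such paths whose first step is horizontal or down. $\mathcal{Q}(m,k)=\bigl(\bigcup_{i=0}^{k-2}\mathcal{FB}'_0(m-i,2k)\bigr)\cup\mathcal{FB}'_{-1}(m+1,2k)$. An $(s,k)$-Dyck path is a free ballot $(s,k)$-path of height $0$ never going below the $x$-axis; it is symmetric if its reflection about the line $x=s/2$ is itself. $\mathcal{SD}(s,k)$ is the set of symmetric $(s,k)$-Dyck paths. *)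

theory Defs
  imports Complex_Main "HOL-Library.Product_Plus"
begin

text \<open>
  A lattice path starting at the origin is given by the list of its step vectors, so that, for
  instance, two horizontal steps of length 1 differ from one horizontal step of length 2.
  Abscissae are real (for odd \<open>k\<close> they are half-integers), heights are integers.
\<close>

type_synonym point = "real \<times> int"

type_synonym lpath = "point list"

definition up_step :: "nat \<Rightarrow> point" where
  "up_step k = (real k / 2, 1)"

definition down_step :: "nat \<Rightarrow> point" where
  "down_step k = (real k / 2, -1)"

definition horizontal_steps :: "nat \<Rightarrow> point set" where
  "horizontal_steps k = {(real l, 0) | l :: nat. 1 \<le> l \<and> l < k}"

definition vertices :: "lpath \<Rightarrow> point list" where
  "vertices p = map (\<lambda>j. sum_list (take j p)) [0..<Suc (length p)]"

definition free_ballot_paths :: "int \<Rightarrow> real \<Rightarrow> nat \<Rightarrow> lpath set" where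
  "free_ballot_paths n s k =
     {p. set p \<subseteq> {up_step k, down_step k} \<union> horizontal_steps k \<and> sum_list p = (s, n)}"

text \<open>
  The condition on the first step is vacuous for the empty path, which therefore belongs to
  \<open>FB' 0 0 k\<close>. This convention matters for \<open>Q m k\<close> when \<open>m \<le> k - 2\<close>: for \<open>m = 1\<close>, \<open>k = 3\<close> the set
  \<open>SD 2 6\<close> has two elements, while \<open>Q 1 3\<close> consists of a single horizontal step and the empty path.
\<close>

definition FB' :: "int \<Rightarrow> real \<Rightarrow> nat \<Rightarrow> lpath set" where
  "FB' n s k =
     {p \<in> free_ballot_paths n s k. p \<noteq> [] \<longrightarrow> hd p \<in> insert (down_step k) (horizontal_steps k)}"

definition Q :: "nat \<Rightarrow> nat \<Rightarrow> lpath set" where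
  "Q m k = (\<Union>i\<in>{0..int k - 2}. FB' 0 (real m - real_of_int i) (2 * k))
             \<union> FB' (-1) (real m + 1) (2 * k)"

definition dyck_paths :: "real \<Rightarrow> nat \<Rightarrow> lpath set" where
  "dyck_paths s k = {p \<in> free_ballot_paths 0 s k. \<forall>v \<in> set (vertices p). snd v \<ge> 0}"

text \<open>
  The reflection about the line \<open>x = s / 2\<close> maps \<open>(x, y)\<close> to \<open>(s - x, y)\<close>; the list of vertices is
  reversed so that the reflected path is again traversed from left to right.
\<close>

definition reflect_vertices :: "real \<Rightarrow> point list \<Rightarrow> point list" where
  "reflect_vertices s vs = rev (map (\<lambda>(x, y). (s - x, y)) vs)"

definition SD :: "real \<Rightarrow> nat \<Rightarrow> lpath set" where
  "SD s k = {p \<in> dyck_paths s k. reflect_vertices s (vertices p) = vertices p}"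

end

theory Submission imports Defs begin

text \<open>
  Let \<open>F h s\<close> be the number of free paths of height \<open>h\<close> and length \<open>s\<close>, for steps of parameter \<open>2k\<close>.
  A symmetric path is determined by its left half, a nonnegative path of length \<open>m - j\<close> where
  \<open>0 \<le> j < k\<close>: either \<open>j = 0\<close>, or the middle step is horizontal of length \<open>2j\<close>. Splitting off the
  first step shows inductively that the paths staying nonnegative from height \<open>c\<close> are
  equinumerous with the free paths whose height lies in \<open>{-c-1..c}\<close>, so the symmetric
  paths are counted by \<open>\<Sum>j<k. F 0 (m - j) + F (-1) (m - j)\<close>. Splitting off the first step also
  gives \<open>F 0 s = |FB' 0 s| + F (-1) (s - k)\<close> and
  \<open>|FB' (-1) (m + 1)| = F 0 (m - (k - 1)) + (\<Sum>j<2k-1. F (-1) (m - j))\<close>,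
  and adding up yields the same count for \<open>Q m k\<close>.
\<close>

section \<open>Splitting off the first step\<close>

definition steps :: "nat \<Rightarrow> point set" where
  "steps k = {up_step k, down_step k} \<union> horizontal_steps k"

lemma horizontal_steps_eq: "horizontal_steps k = (\<lambda>l. (real l, 0)) ` {1..<k}"
  by (auto simp: horizontal_steps_def)

lemma finite_steps: "finite (steps k)"
  by (simp add: steps_def horizontal_steps_eq)

lemma sum_horizontal_steps:
  "(\<Sum>a\<in>horizontal_steps k. f a) = (\<Sum>l\<in>{1..<k}. f (real l, 0))"
  unfolding horizontal_steps_eq by (subst sum.reindex) (auto simp: inj_on_def)

lemma sum_steps:
  "(\<Sum>a\<in>steps k. f a) = f (up_step k) + f (down_step k) + (\<Sum>l\<in>{1..<k}. f (real l, 0))"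
proof -
  have "(\<Sum>a\<in>steps k. f a) = f (up_step k) + (f (down_step k) + (\<Sum>a\<in>horizontal_steps k. f a))"
    by (simp add: steps_def horizontal_steps_eq up_step_def down_step_def image_iff)
  then show ?thesis by (simp add: sum_horizontal_steps add.assoc)
qed

text \<open>Common source of the recursions for free paths, for \<open>FB'\<close> and for
  nonnegative paths. The \<open>of_bool\<close> term counts the empty list.\<close>

lemma card_lists_by_hd:
  fixes X :: "'a list set"
  assumes "finite X" "finite S" and hd: "\<And>a q. a # q \<in> X \<Longrightarrow> a \<in> S"
  shows "card X = of_bool ([] \<in> X) + (\<Sum>a\<in>S. card {q. a # q \<in> X})"
proof -
  have fin: "finite {q. a # q \<in> X}" for a
    using finite_vimageI[OF assms(1), of "(#) a"] by (simp add: vimage_def)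
  have X: "X = (X \<inter> {[]}) \<union> (\<Union>a\<in>S. (#) a ` {q. a # q \<in> X})" (is "_ = _ \<union> ?U")
  proof (intro set_eqI)
    fix p show "p \<in> X \<longleftrightarrow> p \<in> (X \<inter> {[]}) \<union> ?U"
      using hd by (cases p) auto
  qed
  have "card X = card (X \<inter> {[]}) + card ?U"
    by (subst X, rule card_Un_disjoint) (use assms fin in auto)
  also have "card ?U = (\<Sum>a\<in>S. card ((#) a ` {q. a # q \<in> X}))"
    by (rule card_UN_disjoint) (use assms fin in auto)
  also have "\<dots> = (\<Sum>a\<in>S. card {q. a # q \<in> X})"
    by (intro sum.cong refl card_image) auto
  also have "card (X \<inter> {[]}) = of_bool ([] \<in> X)" by (cases "[] \<in> X") auto
  finally show ?thesis .
qed

section \<open>Free paths\<close>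

lemma free_ballot_paths_alt:
  "free_ballot_paths h s k = {p. set p \<subseteq> steps k \<and> sum_list p = (s, h)}"
  by (simp add: free_ballot_paths_def steps_def)

text \<open>For \<open>k > 0\<close> this bound is positive, so the length of a path limits its
  number of steps. It yields finiteness and, later, an induction on a real length.\<close>

lemma fst_step_ge:
  assumes "a \<in> steps k"
  shows "fst a \<ge> min 1 (real k / 2)"
  using assms by (auto simp: steps_def up_step_def down_step_def horizontal_steps_def)

lemma fst_sum_list_ge:
  assumes "set p \<subseteq> steps k"
  shows "real (length p) * min 1 (real k / 2) \<le> fst (sum_list p)"
  using assms
proof (induction p)
  case (Cons a p)
  then show ?case using fst_step_ge[of a k] by (simp add: distrib_right)
qed simp

text \<open>The final height is left open so that free and nonnegative paths are both
  covered.\<close>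

lemma finite_paths_length:
  assumes "k > 0"
  shows "finite {p. set p \<subseteq> steps k \<and> fst (sum_list p) = s}"
proof (rule finite_subset[OF _ finite_lists_length_le[OF finite_steps]])
  define e where "e = min 1 (real k / 2)"
  have "e > 0" using assms by (simp add: e_def)
  show "{p. set p \<subseteq> steps k \<and> fst (sum_list p) = s} \<subseteq>
      {p. set p \<subseteq> steps k \<and> length p \<le> nat \<lfloor>s / e\<rfloor>}"
  proof safe
    fix p assume "set p \<subseteq> steps k"
    from fst_sum_list_ge[OF this] have "real (length p) \<le> fst (sum_list p) / e"
      using \<open>e > 0\<close> by (simp add: e_def[symmetric] pos_le_divide_eq)
    then show "length p \<le> nat \<lfloor>fst (sum_list p) / e\<rfloor>" by linarith
  qed
qed

lemma finite_free_ballot_paths: "k > 0 \<Longrightarrow> finite (free_ballot_paths h s k)"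
  by (rule finite_subset[OF _ finite_paths_length[of k s]]) (auto simp: free_ballot_paths_alt)

lemma fst_sum_list_nonneg:
  assumes "set p \<subseteq> steps k" shows "fst (sum_list p) \<ge> 0"
  using fst_sum_list_ge[OF assms] by (rule order_trans[rotated]) simp

lemma Cons_free_ballot_paths:
  assumes "a \<in> steps k"
  shows "{q. a # q \<in> free_ballot_paths h s k} = free_ballot_paths (h - snd a) (s - fst a) k"
  using assms by (auto simp: free_ballot_paths_alt prod_eq_iff)

lemma card_free_ballot_paths:
  assumes "k > 0"
  shows "card (free_ballot_paths h s k) = of_bool (s = 0 \<and> h = 0)
    + card (free_ballot_paths (h - 1) (s - real k / 2) k)
    + card (free_ballot_paths (h + 1) (s - real k / 2) k)
    + (\<Sum>l\<in>{1..<k}. card (free_ballot_paths h (s - real l) k))"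
proof -
  let ?F = "free_ballot_paths h s k"
  have "card ?F = of_bool ([] \<in> ?F) + (\<Sum>a\<in>steps k. card {q. a # q \<in> ?F})"
    by (rule card_lists_by_hd)
      (use finite_free_ballot_paths[OF assms] finite_steps in \<open>auto simp: free_ballot_paths_alt\<close>)
  also have "(\<Sum>a\<in>steps k. card {q. a # q \<in> ?F}) =
      (\<Sum>a\<in>steps k. card (free_ballot_paths (h - snd a) (s - fst a) k))"
    by (simp add: Cons_free_ballot_paths)
  also have "[] \<in> ?F \<longleftrightarrow> s = 0 \<and> h = 0"
    by (auto simp: free_ballot_paths_alt prod_eq_iff)
  finally show ?thesis by (simp add: sum_steps up_step_def down_step_def)
qed

text \<open>Only the first step is restricted, so the tails are arbitrary free paths. Compared with
  \<open>card_free_ballot_paths\<close>, exactly the up-step term is missing.\<close>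

lemma card_FB':
  assumes "k > 0"
  shows "card (FB' h s k) = of_bool (s = 0 \<and> h = 0)
    + card (free_ballot_paths (h + 1) (s - real k / 2) k)
    + (\<Sum>l\<in>{1..<k}. card (free_ballot_paths h (s - real l) k))"
proof -
  let ?S = "insert (down_step k) (horizontal_steps k)"
  have S: "?S \<subseteq> steps k" by (auto simp: steps_def)
  have "card (FB' h s k) = of_bool ([] \<in> FB' h s k) + (\<Sum>a\<in>?S. card {q. a # q \<in> FB' h s k})"
  proof (rule card_lists_by_hd)
    show "finite (FB' h s k)"
      by (rule finite_subset[OF _ finite_free_ballot_paths[OF assms]]) (auto simp: FB'_def)
    show "finite ?S" by (simp add: horizontal_steps_eq)
  qed (simp add: FB'_def)
  also have "(\<Sum>a\<in>?S. card {q. a # q \<in> FB' h s k}) =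
      (\<Sum>a\<in>?S. card (free_ballot_paths (h - snd a) (s - fst a) k))"
  proof (rule sum.cong[OF refl])
    fix a assume a: "a \<in> ?S"
    then have "{q. a # q \<in> FB' h s k} = {q. a # q \<in> free_ballot_paths h s k}"
      by (simp add: FB'_def)
    with a S Cons_free_ballot_paths[of a k h s]
    show "card {q. a # q \<in> FB' h s k} = card (free_ballot_paths (h - snd a) (s - fst a) k)"
      by auto
  qed
  also have "\<dots> = card (free_ballot_paths (h + 1) (s - real k / 2) k)
      + (\<Sum>a\<in>horizontal_steps k. card (free_ballot_paths (h - snd a) (s - fst a) k))"
    by (subst sum.insert) (auto simp: down_step_def horizontal_steps_eq)
  also have "[] \<in> FB' h s k \<longleftrightarrow> s = 0 \<and> h = 0"
    by (auto simp: FB'_def free_ballot_paths_alt prod_eq_iff)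
  finally show ?thesis by (simp add: sum_horizontal_steps)
qed

section \<open>Nonnegative paths\<close>

text \<open>Paths start at height \<open>c\<close> and may end at any height. The prefix
  \<open>j = 0\<close> is tested too, so the set is empty for \<open>c < 0\<close>; this absorbs a
  down step from height 0 in the recursion.\<close>

definition nonneg_paths :: "int \<Rightarrow> real \<Rightarrow> nat \<Rightarrow> lpath set" where
  "nonneg_paths c s k = {p. set p \<subseteq> steps k \<and> fst (sum_list p) = s \<and>
     (\<forall>j\<le>length p. 0 \<le> c + snd (sum_list (take j p)))}"

lemma finite_nonneg_paths: "k > 0 \<Longrightarrow> finite (nonneg_paths c s k)"
  by (rule finite_subset[OF _ finite_paths_length[of k s]]) (auto simp: nonneg_paths_def)

lemma all_le_Suc_iff: "(\<forall>j\<le>Suc n. P j) \<longleftrightarrow> P 0 \<and> (\<forall>j\<le>n. P (Suc j))"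
  by (metis Suc_le_mono not0_implies_Suc zero_le)

lemma Cons_nonneg_paths:
  assumes "a \<in> steps k" "c \<ge> 0"
  shows "{q. a # q \<in> nonneg_paths c s k} = nonneg_paths (c + snd a) (s - fst a) k"
  using assms by (auto simp: nonneg_paths_def all_le_Suc_iff add.assoc)

lemma card_nonneg_paths_rec:
  assumes "k > 0" "c \<ge> 0"
  shows "card (nonneg_paths c s k) = of_bool (s = 0)
    + card (nonneg_paths (c + 1) (s - real k / 2) k)
    + card (nonneg_paths (c - 1) (s - real k / 2) k)
    + (\<Sum>l\<in>{1..<k}. card (nonneg_paths c (s - real l) k))"
proof -
  let ?F = "nonneg_paths c s k"
  have "card ?F = of_bool ([] \<in> ?F) + (\<Sum>a\<in>steps k. card {q. a # q \<in> ?F})"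
    by (rule card_lists_by_hd)
      (use finite_nonneg_paths[OF assms(1)] finite_steps in \<open>auto simp: nonneg_paths_def\<close>)
  also have "(\<Sum>a\<in>steps k. card {q. a # q \<in> ?F}) =
      (\<Sum>a\<in>steps k. card (nonneg_paths (c + snd a) (s - fst a) k))"
    using assms(2) by (simp add: Cons_nonneg_paths)
  also have "[] \<in> ?F \<longleftrightarrow> s = 0"
    using assms(2) by (auto simp: nonneg_paths_def)
  finally show ?thesis by (simp add: sum_steps up_step_def down_step_def)
qed

text \<open>The two shifts of the interval are \<open>{-c-2..c-1}\<close> and
  \<open>{-c..c+1}\<close>. Moving the block \<open>{c..c+1}\<close> from the second to the first
  leaves the intervals belonging to \<open>c + 1\<close> and \<open>c - 1\<close>.\<close>

lemma sum_neighbours_interval: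
  fixes f :: "int \<Rightarrow> 'a::comm_monoid_add"
  assumes "c \<ge> 0"
  shows "(\<Sum>h\<in>{-c-1..c}. f (h - 1) + f (h + 1)) = sum f {-(c+1)-1..c+1} + sum f {-(c-1)-1..c-1}"
proof -
  have "(\<Sum>h\<in>{-c-1..c}. f (h - 1)) = sum f {-c-2..c-1}"
    by (rule sum.reindex_bij_witness[of _ "\<lambda>h. h + 1" "\<lambda>h. h - 1"]) auto
  moreover have "(\<Sum>h\<in>{-c-1..c}. f (h + 1)) = sum f {-c..c+1}"
    by (rule sum.reindex_bij_witness[of _ "\<lambda>h. h - 1" "\<lambda>h. h + 1"]) auto
  moreover have "sum f {-c..c+1} = sum f {-c..c-1} + sum f {c..c+1}"
    using assms by (subst sum.union_disjoint[symmetric]) (auto intro!: sum.cong)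
  moreover have "sum f {-c-2..c+1} = sum f {-c-2..c-1} + sum f {c..c+1}"
    using assms by (subst sum.union_disjoint[symmetric]) (auto intro!: sum.cong)
  ultimately show ?thesis by (simp add: sum.distrib ac_simps)
qed

text \<open>Both sides satisfy the same first-step recursion for \<open>c \<ge> 0\<close>, and both
  vanish for \<open>c = -1\<close>.\<close>

lemma card_nonneg_paths:
  assumes "k > 0" "c \<ge> -1"
  shows "card (nonneg_paths c s k) = (\<Sum>h\<in>{-c-1..c}. card (free_ballot_paths h s k))"
proof -
  \<comment> \<open>Since \<open>s\<close> is real, the induction runs over \<open>n\<close> with
    \<open>s < n * e\<close>: each step uses up at least \<open>e\<close> of the length. For
    \<open>n = 0\<close> the length is negative and there are no paths.\<close>
  define e where "e = min 1 (real k / 2)"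
  have e: "e > 0" "e \<le> real k / 2" "e \<le> 1" using assms(1) by (auto simp: e_def)
  have "card (nonneg_paths c s k) = (\<Sum>h\<in>{-c-1..c}. card (free_ballot_paths h s k))"
    if "s < real n * e" for n
    using that assms(2)
  proof (induction n arbitrary: s c)
    case 0
    have "nonneg_paths c s k = {}" "free_ballot_paths h s k = {}" for h
      using 0 fst_sum_list_nonneg[of _ k]
      by (force simp: nonneg_paths_def free_ballot_paths_alt)+
    then show ?case by simp
  next
    case (Suc n)
    show ?case
    proof (cases "c = -1")
      case True
      have "nonneg_paths (-1) s k = {}"
        unfolding nonneg_paths_def by (auto intro!: exI[of _ 0])
      with True show ?thesis by simp
    next
      case False
      with Suc.prems have c: "c \<ge> 0" by simp
      let ?F = "\<lambda>h s. card (free_ballot_paths h s k)" and ?d = "s - real k / 2"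
      have less: "?d < real n * e" "\<And>l. l \<ge> 1 \<Longrightarrow> s - real l < real n * e"
        using Suc.prems e by (auto simp: distrib_right)
      have "(\<Sum>h\<in>{-c-1..c}. ?F h s) = (\<Sum>h\<in>{-c-1..c}. of_bool (s = 0 \<and> h = 0))
          + (\<Sum>h\<in>{-c-1..c}. ?F (h - 1) ?d + ?F (h + 1) ?d)
          + (\<Sum>h\<in>{-c-1..c}. \<Sum>l\<in>{1..<k}. ?F h (s - real l))"
        by (subst card_free_ballot_paths[OF assms(1)]) (simp add: sum.distrib)
      also have "(\<Sum>h\<in>{-c-1..c}. of_bool (s = 0 \<and> h = 0)) = (of_bool (s = 0) :: nat)"
      proof -
        have "(\<Sum>h\<in>{-c-1..c}. of_bool (s = 0 \<and> h = 0)) =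
            (\<Sum>h\<in>{-c-1..c}. if h = 0 then of_bool (s = 0) else (0::nat))"
          by (rule sum.cong) auto
        then show ?thesis using c by simp
      qed
      \<comment> \<open>For \<open>c = 0\<close> the induction hypothesis is applied at
        \<open>c - 1 = -1\<close>, which is why the claim includes that value.\<close>
      also have "(\<Sum>h\<in>{-c-1..c}. ?F (h - 1) ?d + ?F (h + 1) ?d) =
          card (nonneg_paths (c + 1) ?d k) + card (nonneg_paths (c - 1) ?d k)"
        using c less(1)
        by (subst sum_neighbours_interval[OF c], subst (1 2) Suc.IH) auto
      also have "(\<Sum>h\<in>{-c-1..c}. \<Sum>l\<in>{1..<k}. ?F h (s - real l)) =
          (\<Sum>l\<in>{1..<k}. card (nonneg_paths c (s - real l) k))"
        using c less(2) by (subst sum.swap) (auto intro!: sum.cong simp: Suc.IH)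
      finally show ?thesis using card_nonneg_paths_rec[OF assms(1) c, of s] by simp
    qed
  qed
  then show ?thesis
    using ex_less_of_nat_mult[OF e(1), of s] by (elim exE)
qed

section \<open>Reflection of paths\<close>

text \<open>Reflection in a vertical line turns \<open>(x, y)\<close> into \<open>(-x, y)\<close>;
  traversing the step backwards then negates both coordinates.\<close>

definition mirror_step :: "point \<Rightarrow> point" where
  "mirror_step a = (fst a, - snd a)"

definition mirror :: "lpath \<Rightarrow> lpath" where
  "mirror p = rev (map mirror_step p)"

lemma length_mirror [simp]: "length (mirror p) = length p"
  by (simp add: mirror_def)

lemma mirror_append: "mirror (p @ q) = mirror q @ mirror p"
  by (simp add: mirror_def)

lemma mirror_mirror [simp]: "mirror (mirror p) = p"
  by (simp add: mirror_def rev_map o_def mirror_step_def)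

lemma set_mirror: "set p \<subseteq> steps k \<Longrightarrow> set (mirror p) \<subseteq> steps k"
proof -
  have "mirror_step a \<in> steps k" if "a \<in> steps k" for a
    using that by (auto simp: mirror_step_def steps_def up_step_def down_step_def horizontal_steps_def)
  then show "set p \<subseteq> steps k \<Longrightarrow> set (mirror p) \<subseteq> steps k"
    by (auto simp: mirror_def)
qed

lemma sum_list_mirror: "sum_list (mirror p) = mirror_step (sum_list p)"
  by (induction p) (auto simp: mirror_def mirror_step_def prod_eq_iff)

text \<open>The first \<open>j\<close> steps of \<open>mirror p\<close> are the mirrored last
  \<open>j\<close> steps of \<open>p\<close>.\<close>

lemma sum_list_take_mirror:
  assumes "j \<le> length p"
  shows "sum_list (take j (mirror p)) =
    mirror_step (sum_list p - sum_list (take (length p - j) p))"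
proof -
  have "take j (mirror p) = mirror (drop (length p - j) p)"
    using assms by (simp add: mirror_def take_rev drop_map)
  moreover have "sum_list (drop (length p - j) p) = sum_list p - sum_list (take (length p - j) p)"
    by (metis add_diff_cancel_left' append_take_drop_id sum_list_append)
  ultimately show ?thesis by (simp add: sum_list_mirror)
qed

lemma length_vertices [simp]: "length (vertices p) = Suc (length p)"
  by (simp add: vertices_def)

lemma nth_vertices: "j \<le> length p \<Longrightarrow> vertices p ! j = sum_list (take j p)"
  unfolding vertices_def by (subst nth_map) (auto simp del: upt_Suc)

text \<open>Steps are differences of consecutive vertices. Hence symmetry of the vertex list amounts
  to \<open>mirror p = p\<close>.\<close>

lemma vertices_inject:
  assumes "vertices p = vertices q" shows "p = q"
proof (rule nth_equalityI)
  from arg_cong[OF assms, of length] show len: "length p = length q" by simp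
  fix j assume j: "j < length p"
  have step: "r ! j = vertices r ! Suc j - vertices r ! j" if "j < length r" for r
    using that by (simp add: nth_vertices take_Suc_conv_app_nth)
  show "p ! j = q ! j" using step[of p] step[of q] j len assms by simp
qed

lemma vertices_mirror:
  assumes "sum_list p = (s, 0)"
  shows "vertices (mirror p) = reflect_vertices s (vertices p)"
proof (rule nth_equalityI)
  fix j assume "j < length (vertices (mirror p))"
  then have j: "j \<le> length p" by simp
  then show "vertices (mirror p) ! j = reflect_vertices s (vertices p) ! j"
    by (simp add: nth_vertices reflect_vertices_def rev_nth sum_list_take_mirror assms
        mirror_step_def split_beta)
qed (simp add: reflect_vertices_def)

lemma SD_alt:
  "SD s k = {p. set p \<subseteq> steps k \<and> sum_list p = (s, 0) \<and>
     (\<forall>j\<le>length p. 0 \<le> snd (sum_list (take j p))) \<and> mirror p = p}"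
proof -
  have "(\<forall>v\<in>set (vertices p). snd v \<ge> 0) \<longleftrightarrow> (\<forall>j\<le>length p. 0 \<le> snd (sum_list (take j p)))" for p
    by (auto simp: vertices_def less_Suc_eq_le simp del: upt_Suc)
  moreover have "reflect_vertices s (vertices p) = vertices p \<longleftrightarrow> mirror p = p"
    if "sum_list p = (s, 0)" for p
    using vertices_mirror[OF that] vertices_inject[of "mirror p" p] by auto
  ultimately show ?thesis
    by (auto simp: SD_def dyck_paths_def free_ballot_paths_alt)
qed

section \<open>Left halves of symmetric paths\<close>

text \<open>The middle step spans twice the distance from the end of \<open>q\<close> to the axis of
  symmetry. It is omitted at distance 0, since horizontal steps have positive length.\<close>

definition symmetrize :: "nat \<Rightarrow> lpath \<Rightarrow> lpath" where
  "symmetrize m q = (let x = fst (sum_list q) in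
     q @ (if x = real m then [] else [(2 * (real m - x), 0)]) @ mirror q)"

text \<open>The length is \<open>2 * length q\<close> or one more. This left inverse makes
  \<open>symmetrize m\<close> injective.\<close>

lemma take_symmetrize: "take (length (symmetrize m q) div 2) (symmetrize m q) = q"
  by (simp add: symmetrize_def Let_def)

lemma mirror_symmetrize: "mirror (symmetrize m q) = symmetrize m q"
  by (simp add: symmetrize_def Let_def mirror_append) (simp add: mirror_def mirror_step_def)

lemma symmetrize_in_SD:
  assumes q: "q \<in> nonneg_paths 0 (real m - real j) (2 * k)" and j: "j < k"
  shows "symmetrize m q \<in> SD (2 * real m) (2 * k)"
proof -
  let ?p = "symmetrize m q"
  have q': "set q \<subseteq> steps (2 * k)" "fst (sum_list q) = real m - real j"
    and nn: "\<And>i. i \<le> length q \<Longrightarrow> 0 \<le> snd (sum_list (take i q))"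
    using q by (auto simp: nonneg_paths_def)
  obtain b where p: "?p = q @ b @ mirror q" and b: "length b \<le> 1" "set b \<subseteq> steps (2 * k)"
    "sum_list b = (2 * real j, 0)"
  proof
    let ?b = "if j = 0 then [] else [(2 * real j, 0)]"
    show "?p = q @ ?b @ mirror q" using q' by (simp add: symmetrize_def)
    show "set ?b \<subseteq> steps (2 * k)"
      using j by (auto simp: steps_def horizontal_steps_def intro!: exI[of _ "2 * j"])
  qed (auto simp: prod_eq_iff)
  have sum: "sum_list ?p = (2 * real m, 0)"
    using q' b by (simp add: p sum_list_mirror mirror_step_def prod_eq_iff)
  have half: "0 \<le> snd (sum_list (take i ?p))" if "i \<le> length q" for i
    using nn[OF that] that by (simp add: p)
  have "0 \<le> snd (sum_list (take i ?p))" if "i \<le> length ?p" for i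
  proof (cases "i \<le> length q")
    case False
    \<comment> \<open>Beyond the left half, the height at \<open>i\<close> equals the height at the
      mirrored index, which lies in the left half because \<open>b\<close> has at most one
      step.\<close>
    with b(1) that have "length ?p - i \<le> length q" by (simp add: p)
    from half[OF this] sum_list_take_mirror[OF that] show ?thesis
      by (simp add: mirror_symmetrize sum mirror_step_def)
  qed (rule half)
  moreover have "set ?p \<subseteq> steps (2 * k)" using q' b set_mirror[of q "2 * k"] by (auto simp: p)
  ultimately show ?thesis by (simp add: SD_alt sum mirror_symmetrize)
qed

text \<open>With the even parameter \<open>2 * k\<close> slanted steps have integer length
  \<open>k\<close>. This forces the middle step of a symmetric path to have even length.\<close>

lemma fst_sum_list_Ints:
  "set p \<subseteq> steps (2 * k) \<Longrightarrow> fst (sum_list p) \<in> \<int>"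
  by (induction p) (auto simp: steps_def up_step_def down_step_def horizontal_steps_def)

lemma SD_cases:
  assumes p: "p \<in> SD (2 * real m) (2 * k)" and "k > 0"
  obtains j q where "j < k" "q \<in> nonneg_paths 0 (real m - real j) (2 * k)" "p = symmetrize m q"
proof -
  \<comment> \<open>Here \<open>b\<close> is the middle step if the number of steps is odd, and
    empty otherwise.\<close>
  define n q b where "n = length p div 2" and "q = take n p"
    and "b = take (length p - 2 * n) (drop n p)"
  have pS: "set p \<subseteq> steps (2 * k)" "sum_list p = (2 * real m, 0)" "mirror p = p"
    and nn: "\<And>i. i \<le> length p \<Longrightarrow> 0 \<le> snd (sum_list (take i p))"
    using p by (auto simp: SD_alt)
  have "drop (length p - n) p = drop (length p - n) (mirror p)" by (simp add: pS)
  also have "\<dots> = mirror q"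
    by (simp add: mirror_def q_def drop_rev take_map n_def)
  finally have "drop (length p - 2 * n) (drop n p) = mirror q"
    by (simp add: n_def)
  then have pq: "p = q @ b @ mirror q"
    by (metis append_take_drop_id b_def q_def)
  have b1: "length b \<le> 1" by (simp add: b_def n_def)
  have bm: "mirror b = b" using pS(3) unfolding pq by (simp add: mirror_append)
  have qS: "set q \<subseteq> steps (2 * k)" and bS: "set b \<subseteq> steps (2 * k)" using pS(1) by (auto simp: pq)
  have x: "2 * fst (sum_list q) + fst (sum_list b) = 2 * real m"
    using arg_cong[OF pS(2), of fst] by (simp add: pq sum_list_mirror mirror_step_def)
  obtain z where z: "fst (sum_list q) = of_int z" using fst_sum_list_Ints[OF qS] by (auto elim: Ints_cases)
  obtain j where j: "j < k" "sum_list b = (2 * real j, 0)" "b = (if j = 0 then [] else [(2 * real j, 0)])"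
  proof (cases b)
    case Nil
    with that[of 0] \<open>k > 0\<close> show thesis by (simp add: prod_eq_iff)
  next
    case (Cons a b')
    with b1 have ba: "b = [a]" by simp
    \<comment> \<open>A step equal to its own mirror image satisfies
      \<open>snd a = - snd a\<close>.\<close>
    with bm have "snd a = 0" by (auto simp: mirror_def mirror_step_def prod_eq_iff)
    with bS ba obtain l where l: "a = (real l, 0)" "1 \<le> l" "l < 2 * k"
      by (auto simp: steps_def up_step_def down_step_def horizontal_steps_def)
    have "real_of_int (int l) = of_int (2 * (int m - z))" using x z ba l by simp
    then have "int l = 2 * (int m - z)" by (simp only: of_int_eq_iff)
    then have "l = 2 * (l div 2)" by presburger
    then obtain j where "l = 2 * j" by blast
    with that[of j] l ba show thesis by (simp add: prod_eq_iff)
  qed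
  have xq: "fst (sum_list q) = real m - real j" using x j(2) by simp
  show thesis
  proof (rule that[OF j(1)])
    show "q \<in> nonneg_paths 0 (real m - real j) (2 * k)"
      using qS xq nn by (auto simp: nonneg_paths_def q_def min_def)
    show "p = symmetrize m q" using xq j(3) pq by (simp add: symmetrize_def)
  qed
qed

lemma card_SD:
  assumes "k > 0"
  shows "finite (SD (2 * real m) (2 * k))"
    and "card (SD (2 * real m) (2 * k)) = (\<Sum>j<k. card (nonneg_paths 0 (real m - real j) (2 * k)))"
proof -
  let ?N = "\<lambda>j. nonneg_paths 0 (real m - real j) (2 * k)"
  have SD: "SD (2 * real m) (2 * k) = symmetrize m ` (\<Union>j<k. ?N j)"
  proof (intro equalityI subsetI)
    fix p assume "p \<in> SD (2 * real m) (2 * k)"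
    then obtain j q where "j < k" "q \<in> ?N j" "p = symmetrize m q"
      using SD_cases[OF _ assms] by metis
    then show "p \<in> symmetrize m ` (\<Union>j<k. ?N j)" by blast
  next
    fix p assume "p \<in> symmetrize m ` (\<Union>j<k. ?N j)"
    then obtain j q where "j < k" "q \<in> ?N j" "p = symmetrize m q" by blast
    then show "p \<in> SD (2 * real m) (2 * k)" by (simp only: symmetrize_in_SD)
  qed
  have fin: "finite (?N j)" for j using assms by (simp add: finite_nonneg_paths)
  with SD show "finite (SD (2 * real m) (2 * k))" by simp
  have "inj (symmetrize m)" by (rule inj_on_inverseI) (rule take_symmetrize)
  then have "card (SD (2 * real m) (2 * k)) = card (\<Union>j<k. ?N j)"
    unfolding SD by (intro card_image) (auto intro: inj_on_subset)
  also have "\<dots> = (\<Sum>j<k. card (?N j))"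
    \<comment> \<open>Disjoint because the length of a left half determines
      \<open>j\<close>.\<close>
    by (rule card_UN_disjoint) (use fin in \<open>auto simp: nonneg_paths_def\<close>)
  finally show "card (SD (2 * real m) (2 * k)) = (\<Sum>j<k. card (?N j))" .
qed

section \<open>Counting both sides\<close>

lemma card_Q:
  assumes "k > 0"
  shows "finite (Q m k)"
    and "card (Q m k) = (\<Sum>i<k-1. card (FB' 0 (real m - real i) (2 * k)))
      + card (FB' (-1) (real m + 1) (2 * k))"
proof -
  let ?A = "\<lambda>i. FB' 0 (real m - real i) (2 * k)"
  have fin: "finite (FB' h s (2 * k))" for h s
    by (rule finite_subset[OF _ finite_free_ballot_paths[of "2 * k" h s]])
      (use assms in \<open>auto simp: FB'_def\<close>)
  have "{0..int k - 2} = int ` {..<k-1}"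
    by (auto simp: image_iff intro!: bexI[of _ "nat _"])
  then have Q: "Q m k = (\<Union>i<k-1. ?A i) \<union> FB' (-1) (real m + 1) (2 * k)"
    by (simp add: Q_def)
  then show "finite (Q m k)" using fin by simp
  have "card (Q m k) = card (\<Union>i<k-1. ?A i) + card (FB' (-1) (real m + 1) (2 * k))"
    \<comment> \<open>Final heights 0 and -1 separate these two parts; within the first part, the
      lengths separate the sets.\<close>
    unfolding Q by (rule card_Un_disjoint) (use fin in \<open>auto simp: FB'_def free_ballot_paths_alt zero_prod_def\<close>)
  also have "card (\<Union>i<k-1. ?A i) = (\<Sum>i<k-1. card (?A i))"
    by (rule card_UN_disjoint) (use fin in \<open>auto simp: FB'_def free_ballot_paths_alt zero_prod_def\<close>)
  finally show "card (Q m k) = (\<Sum>i<k-1. card (?A i)) + card (FB' (-1) (real m + 1) (2 * k))" .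
qed

lemma sum_lessThan_add:
  fixes f :: "nat \<Rightarrow> 'a::comm_monoid_add"
  shows "sum f {..<k + r} = sum f {..<k} + (\<Sum>j<r. f (k + j))"
  by (induction r) (simp_all add: add.assoc)

lemma card_Q_eq_card_SD:
  assumes "k > 0"
  shows "card (Q m k) = card (SD (2 * real m) (2 * k))"
proof -
  define F where "F h s = card (free_ballot_paths h s (2 * k))" for h s
  obtain r where k: "k = Suc r" using assms by (cases k) auto
  \<comment> \<open>The recursions for \<open>F\<close> and \<open>FB'\<close> differ only by the
    up-step term, and half of \<open>2 * k\<close> is \<open>k\<close>.\<close>
  have FB0: "F 0 s = card (FB' 0 s (2 * k)) + F (-1) (s - real k)" for s
    using card_free_ballot_paths[of "2 * k" 0 s] card_FB'[of "2 * k" 0 s] assms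
    by (simp add: F_def)
  \<comment> \<open>Length remaining after an initial down step of a path in
    \<open>FB' (-1) (m + 1)\<close>; its remaining height is 0.\<close>
  have shift: "real m + 1 - real k = real m - real r" by (simp add: k)
  \<comment> \<open>Substitute \<open>l = j + 1\<close>; the upper limit is
    \<open>2 * k - 1 = k + r\<close>. The sum is then cut at \<open>k\<close>.\<close>
  have "(\<Sum>l\<in>{1..<2*k}. F (-1) (real m + 1 - real l)) = (\<Sum>j<k+r. F (-1) (real m - real j))"
    by (rule sum.reindex_bij_witness[of _ Suc "\<lambda>l. l - 1"])
      (auto simp: k of_nat_diff algebra_simps)
  also have "\<dots> = (\<Sum>j<k. F (-1) (real m - real j)) + (\<Sum>j<r. F (-1) (real m - real j - real k))"
    by (simp add: sum_lessThan_add algebra_simps)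
  finally have FB1: "card (FB' (-1) (real m + 1) (2 * k)) = F 0 (real m - real r)
      + (\<Sum>j<k. F (-1) (real m - real j)) + (\<Sum>j<r. F (-1) (real m - real j - real k))"
    using card_FB'[of "2 * k" "-1" "real m + 1"] assms by (simp add: F_def shift)
  have "card (Q m k) = (\<Sum>i<r. card (FB' 0 (real m - real i) (2 * k)))
      + (\<Sum>j<r. F (-1) (real m - real j - real k)) + F 0 (real m - real r)
      + (\<Sum>j<k. F (-1) (real m - real j))"
    using card_Q(2)[OF assms, of m] FB1 by (simp add: k)
  \<comment> \<open>For \<open>j < r\<close>, \<open>FB0\<close> merges the \<open>FB'\<close> term
    with the \<open>F (-1)\<close> term shifted by \<open>k\<close> into \<open>F 0 (m - j)\<close>.
    The isolated \<open>F 0 (m - r)\<close> supplies the last index, as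
    \<open>k = Suc r\<close>.\<close>
  also have "\<dots> = (\<Sum>j<k. F 0 (real m - real j)) + (\<Sum>j<k. F (-1) (real m - real j))"
    by (simp add: FB0 sum.distrib k)
  also have "\<dots> = (\<Sum>j<k. card (nonneg_paths 0 (real m - real j) (2 * k)))"
  proof -
    have "{-1..0::int} = {-1, 0}" by auto
    then show ?thesis
      using assms by (simp add: card_nonneg_paths F_def sum.distrib)
  qed
  finally show ?thesis by (simp add: card_SD(2)[OF assms])
qed

theorem theorem2p20:
  fixes m k :: nat
  assumes "m > 0" and "k > 0"
  shows "\<exists>f. bij_betw f (Q m k) (SD (2 * real m) (2 * k))"
  by (rule finite_same_card_bij[OF card_Q(1) card_SD(1) card_Q_eq_card_SD]) (rule assms(2))+

end
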